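(* Let $k,m,n$ be positive integers with $m\le k$. Then $L^k(m,n)$ is isomorphic to the induced subposet of $L(m,n)$ whose vertices are restricted to the partitions in $L^k(m,n)$. Equivalently, for $\lambda,\mu\in L^k(m,n)$, $$\mu\preceq\lambda\iff\mu\subseteq\lambda .$$
   Context: Fix an integer $k\ge1$. A partition $\lambda=(\lambda_1\ge\dots\ge\lambda_\ell>0)$ is a finite (possibly empty) non-increasing sequence of positive integers, $|\lambda|=\sum_i\lambda_i$, $\ell(\lambda)$ is the number of parts, and $\lambda_i=0$ for $i>\ell(\lambda)$. Its diagram is the set of cells $(i,j)$ with $1\le j\le\lambda_i$ (row $i$, column $j$; row 1 is the lowest row, and "above" means larger row index). $\lambda\subseteq\mu$ means $\lambda_i\le\mu_i$ for all $i$. A partition is $k$-bounded if $\lambda_1\le k$; $\mathcal P^k$ is the set of $k$-bounded partitions. $(m^n)$ is the partition with $n$ parts equal to $m$. $L(m,n)$ is the poset of partitions with at most $n$ parts, each at most $m$, ordered by $\subseteq$. For partitions $\rho\subseteq\gamma$, the skew diagram $\gamma/\rho$ is $\{(i,j):\rho_i<j\le\gamma_i\}$; the squares of $\rho$ are said to lie below $\gamma/\rho$. For a square $(i,j)\in\gamma$ (possibly in $\rho$), its hook-length in $\gamma/\rho$ is the number of cells of $\gamma/\rho$ of the form $(i,j')$ with $j'\ge j$ or $(i',j)$ with $i'\ge i$. For $\lambda\in\mathcal P^k$, the $k$-skew diagram $\lambda/^k$ is the unique skew diagram such that (i) row $i$ has $\lambda_i$ cells, (ii) no cell of the diagram has hook-length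 exceeding $k$, (iii) every square below the diagram has hook-length exceeding $k$. The column lengths of $\lambda/^k$ form a $k$-bounded partition, called the $k$-conjugate $\lambda^{\omega_k}$. For $\lambda,\mu\in\mathcal P^k$ write $\lambda\prec\!\!\cdot\,\mu$ when $\lambda\subseteq\mu$, $\lambda^{\omega_k}\subseteq\mu^{\omega_k}$ and $|\mu|-|\lambda|=1$. The partial order $\preceq$ on $\mathcal P^k$ is the reflexive-transitive closure of $\prec\!\!\cdot$; the resulting poset is $Y^k$. For $1\le m\le k$ and $n\ge1$, $L^k(m,n)=\{\mu\in\mathcal P^k:\mu\preceq(m^n)\}$ is the principal order ideal of $Y^k$ generated by $(m^n)$, ordered by $\preceq$. *)

theory Defs
  imports "HOL-Library.More_List"
begin

text \<open>
  A partition is the list of its positive parts; \<open>nth_default 0 \<nu> i\<close> is its \<open>i\<close>-th part, which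
  is \<open>0\<close> beyond the last one. Rows and columns are numbered from \<open>0\<close>, so the diagram of \<open>\<nu>\<close>
  consists of the cells \<open>(i, j)\<close> with \<open>j < nth_default 0 \<nu> i\<close>.
\<close>

definition is_partition :: "nat list \<Rightarrow> bool" where
  "is_partition \<nu> \<longleftrightarrow> sorted_wrt (\<ge>) \<nu> \<and> 0 \<notin> set \<nu>"

definition contained :: "nat list \<Rightarrow> nat list \<Rightarrow> bool" where
  "contained \<nu> \<mu> \<longleftrightarrow> (\<forall>i. nth_default 0 \<nu> i \<le> nth_default 0 \<mu> i)"

definition bounded_partitions :: "nat \<Rightarrow> nat list set" where
  "bounded_partitions k = {\<nu>. is_partition \<nu> \<and> nth_default 0 \<nu> 0 \<le> k}"

definition L :: "nat \<Rightarrow> nat \<Rightarrow> nat list set" where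
  "L m n = {\<nu>. is_partition \<nu> \<and> length \<nu> \<le> n \<and> (\<forall>p\<in>set \<nu>. p \<le> m)}"

definition diagram :: "nat list \<Rightarrow> (nat \<times> nat) set" where
  "diagram \<nu> = {(i, j). j < nth_default 0 \<nu> i}"

definition skew_diagram :: "nat list \<Rightarrow> nat list \<Rightarrow> (nat \<times> nat) set" where
  "skew_diagram \<gamma> \<rho> = {(i, j). nth_default 0 \<rho> i \<le> j \<and> j < nth_default 0 \<gamma> i}"

text \<open>The corner \<open>(i, j)\<close> itself is counted only when it belongs to \<open>D\<close>.\<close>

definition hook_length :: "(nat \<times> nat) set \<Rightarrow> nat \<Rightarrow> nat \<Rightarrow> nat" where
  "hook_length D i j = card {(a, b) \<in> D. (a = i \<and> b \<ge> j) \<or> (b = j \<and> a \<ge> i)}"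

definition is_k_skew :: "nat \<Rightarrow> nat list \<Rightarrow> nat list \<Rightarrow> nat list \<Rightarrow> bool" where
  "is_k_skew k \<nu> \<gamma> \<rho> \<longleftrightarrow>
     is_partition \<gamma> \<and> is_partition \<rho> \<and> contained \<rho> \<gamma> \<and>
     (\<forall>i. card {j. (i, j) \<in> skew_diagram \<gamma> \<rho>} = nth_default 0 \<nu> i) \<and>
     (\<forall>(i, j) \<in> skew_diagram \<gamma> \<rho>. hook_length (skew_diagram \<gamma> \<rho>) i j \<le> k) \<and>
     (\<forall>(i, j) \<in> diagram \<rho>. hook_length (skew_diagram \<gamma> \<rho>) i j > k)"

text \<open>
  The \<open>k\<close>-skew diagram of a \<open>k\<close>-bounded \<open>\<nu>\<close>, as a pair \<open>(\<gamma>, \<rho>)\<close>. In general several pairs can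
  have the same cells, but here the cells determine the pair: the top row of \<open>\<gamma>\<close> contains no
  square of \<open>\<rho>\<close>, since the last such square would have hook-length at most \<open>k\<close>. So \<open>\<gamma>\<close> has
  exactly as many rows as \<open>\<nu>\<close>, and none of them is empty in the skew diagram.
\<close>

definition k_skew :: "nat \<Rightarrow> nat list \<Rightarrow> nat list \<times> nat list" where
  "k_skew k \<nu> = (THE (\<gamma>, \<rho>). is_k_skew k \<nu> \<gamma> \<rho>)"

text \<open>
  Column lengths from left to right. Every column \<open>j < nth_default 0 \<gamma> 0\<close> contains a cell: the
  topmost square of a column lying entirely in \<open>\<rho>\<close> would have hook-length at most \<open>k\<close>.
\<close>

definition k_conjugate :: "nat \<Rightarrow> nat list \<Rightarrow> nat list" where
  "k_conjugate k \<nu> =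
     (case k_skew k \<nu> of (\<gamma>, \<rho>) \<Rightarrow>
       map (\<lambda>j. card {i. (i, j) \<in> skew_diagram \<gamma> \<rho>}) [0..<nth_default 0 \<gamma> 0])"

definition Y_cover :: "nat \<Rightarrow> nat list \<Rightarrow> nat list \<Rightarrow> bool" where
  "Y_cover k \<nu> \<mu> \<longleftrightarrow>
     \<nu> \<in> bounded_partitions k \<and> \<mu> \<in> bounded_partitions k \<and>
     contained \<nu> \<mu> \<and> contained (k_conjugate k \<nu>) (k_conjugate k \<mu>) \<and>
     sum_list \<mu> = sum_list \<nu> + 1"

text \<open>This closure is also reflexive outside \<^term>\<open>bounded_partitions k\<close>, the carrier of the poset.\<close>

definition Y_le :: "nat \<Rightarrow> nat list \<Rightarrow> nat list \<Rightarrow> bool" where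
  "Y_le k = (Y_cover k)\<^sup>*\<^sup>*"

definition Lk :: "nat \<Rightarrow> nat \<Rightarrow> nat \<Rightarrow> nat list set" where
  "Lk k m n = {\<mu> \<in> bounded_partitions k. Y_le k \<mu> (replicate n m)}"

definition poset_isomorphic ::
  "'a set \<Rightarrow> ('a \<Rightarrow> 'a \<Rightarrow> bool) \<Rightarrow> 'b set \<Rightarrow> ('b \<Rightarrow> 'b \<Rightarrow> bool) \<Rightarrow> bool" where
  "poset_isomorphic A leA B leB \<longleftrightarrow>
     (\<exists>f. bij_betw f A B \<and> (\<forall>x\<in>A. \<forall>y\<in>A. leA x y \<longleftrightarrow> leB (f x) (f y)))"

end

theory Submission
  imports Defs
begin

text \<open>
  The theorem says that containment of \<open>k\<close>-conjugates, which in general is an extra condition on a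
  cover, costs nothing inside the ideal. The reason is that below a rectangle of width \<open>m\<close> the
  column lengths of \<open>\<nu>/\<^sup>k\<close> are an explicit monotone function of the diagram of \<open>\<nu>\<close>.

  The \<open>k\<close>-skew diagram is built from the top row downwards: below rows with column lengths \<open>c\<close>, a
  row of \<open>x\<close> cells must start in the first column \<open>j\<close> with \<open>c j + x \<le> k\<close>. This gives existence and
  uniqueness of the \<open>k\<close>-skew diagram, and a recursion \<open>k_columns\<close> for its column lengths.

  Put \<open>p = k + 1 - m\<close>, and consider the partitions with parts at most \<open>m\<close> of which at most \<open>p\<close> are
  smaller than \<open>m\<close> (\<open>few_short_rows\<close>). A row of \<open>m\<close> cells starts in the first column of length
  less than \<open>p\<close>. So every column \<open>i < m\<close> of the ordinary diagram of \<open>\<nu>\<close> is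
  cut into pieces of length \<open>p\<close>, followed by a shorter remainder, and these pieces become the
  columns \<open>i, i + m, i + 2 * m, \<dots>\<close> of \<open>\<nu>/\<^sup>k\<close> (\<open>k_columns_few_short_rows\<close>). The lengths of the pieces
  can only grow when \<open>\<nu>\<close> grows, so within this set of partitions adding one cell is always a cover.
  Two nested members of the set are joined by a chain of such steps, because a cell added in the
  first row where they differ does not lead out of the set (\<open>add_cell_few_short_rows\<close>).

  It remains to see that everything below \<open>(m\<^sup>n)\<close> belongs to the set. By the formula its members
  have no column longer than \<open>p\<close>, whereas with more than \<open>p\<close> short rows the first column has
  length at least \<open>p + 1\<close> (\<open>many_short_rows_column_0\<close>). A cover does not shorten any column, so
  going down a cover never leaves the set (\<open>few_short_rows_down_closed\<close>).
\<close>

section \<open>Partitions as antitone sequences\<close>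

lemma partition_antitone:
  assumes "is_partition \<nu>" "i \<le> j"
  shows "nth_default 0 \<nu> j \<le> nth_default 0 \<nu> i"
  using assms unfolding is_partition_def nth_default_def sorted_wrt_iff_nth_less
  by (cases "i = j") auto

lemma partition_nth_default_eq_0_iff:
  assumes "is_partition \<nu>"
  shows "nth_default 0 \<nu> i = 0 \<longleftrightarrow> length \<nu> \<le> i"
  using assms unfolding is_partition_def nth_default_def by (auto simp: in_set_conv_nth)

lemma is_partitionI:
  assumes "\<And>i j. i \<le> j \<Longrightarrow> nth_default 0 \<nu> j \<le> nth_default 0 \<nu> i" "0 \<notin> set \<nu>"
  shows "is_partition \<nu>"
  unfolding is_partition_def sorted_wrt_iff_nth_less
proof (intro conjI allI impI)
  fix i j assume "i < j" "j < length \<nu>"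
  then show "\<nu> ! j \<le> \<nu> ! i" using assms(1)[of i j] by (simp add: nth_default_def)
qed (use assms in auto)

lemma partition_eqI:
  assumes "is_partition \<nu>" "is_partition \<mu>" "\<And>i. nth_default 0 \<nu> i = nth_default 0 \<mu> i"
  shows "\<nu> = \<mu>"
proof (rule nth_equalityI)
  show len: "length \<nu> = length \<mu>"
    using partition_nth_default_eq_0_iff[OF assms(1)] partition_nth_default_eq_0_iff[OF assms(2)]
      assms(3) by (metis le_antisym order_refl)
  show "\<nu> ! i = \<mu> ! i" if "i < length \<nu>" for i
    using assms(3)[of i] that len by (simp add: nth_default_def)
qed

lemma is_partition_Cons_iff:
  "is_partition (x # xs) \<longleftrightarrow> 0 < x \<and> nth_default 0 xs 0 \<le> x \<and> is_partition xs"
proof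
  assume "is_partition (x # xs)"
  then show "0 < x \<and> nth_default 0 xs 0 \<le> x \<and> is_partition xs"
    by (cases xs) (auto simp: is_partition_def)
next
  assume "0 < x \<and> nth_default 0 xs 0 \<le> x \<and> is_partition xs"
  then show "is_partition (x # xs)"
    by (cases xs) (auto simp: is_partition_def)
qed

lemma is_partition_tl: "is_partition \<nu> \<Longrightarrow> is_partition (tl \<nu>)"
  by (cases \<nu>) (auto simp: is_partition_Cons_iff)

lemma nth_default_tl: "nth_default d (tl xs) i = nth_default d xs (Suc i)"
  by (cases xs) auto

lemma bounded_partitions_iff:
  "\<nu> \<in> bounded_partitions k \<longleftrightarrow> is_partition \<nu> \<and> (\<forall>x\<in>set \<nu>. x \<le> k)"
  unfolding bounded_partitions_def is_partition_def
  by (cases \<nu>) auto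

lemma bounded_partitions_Cons_iff:
  "x # xs \<in> bounded_partitions k \<longleftrightarrow>
     0 < x \<and> x \<le> k \<and> nth_default 0 xs 0 \<le> x \<and> xs \<in> bounded_partitions k"
  unfolding bounded_partitions_def by (auto simp: is_partition_Cons_iff)

section \<open>The column lengths of the k-skew diagram\<close>

text \<open>
  When a row of \<open>x\<close> cells is put below a diagram with column lengths \<open>c\<close>, the hook-length at its
  first cell, in column \<open>j\<close>, is \<open>c j + x\<close>; the same expression is the hook-length at an empty square
  in column \<open>j\<close> to the left of the row. The conditions on hook-lengths therefore leave exactly one
  place where the row can start.
\<close>

definition row_start :: "nat \<Rightarrow> nat \<Rightarrow> (nat \<Rightarrow> nat) \<Rightarrow> nat" where
  "row_start k x c = (LEAST j. c j + x \<le> k)"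

text \<open>
  The head of the list is the lowest row of the diagram, hence the last one to be placed. The
  result is a function on all columns, \<open>0\<close> beyond the diagram, so that containment is the pointwise
  order.
\<close>

fun k_columns :: "nat \<Rightarrow> nat list \<Rightarrow> nat \<Rightarrow> nat" where
  "k_columns k [] = (\<lambda>j. 0)"
| "k_columns k (x # xs) = (\<lambda>j. k_columns k xs j +
     (if row_start k x (k_columns k xs) \<le> j \<and> j < row_start k x (k_columns k xs) + x
      then 1 else 0))"

lemma k_columns_eventually_0: "\<exists>N. \<forall>j\<ge>N. k_columns k \<nu> j = 0"
proof (induction \<nu>)
  case (Cons x xs)
  then obtain N where "\<forall>j\<ge>N. k_columns k xs j = 0" by blast
  then show ?case
    by (intro exI[of _ "max N (row_start k x (k_columns k xs) + x)"]) auto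
qed auto

lemma row_start_fits:
  assumes "x \<le> k"
  shows "k_columns k xs (row_start k x (k_columns k xs)) + x \<le> k"
proof -
  obtain N where "\<forall>j\<ge>N. k_columns k xs j = 0" using k_columns_eventually_0 by blast
  then have "k_columns k xs N + x \<le> k" using assms by simp
  then show ?thesis unfolding row_start_def by (rule LeastI)
qed

lemma before_row_start: "j < row_start k x c \<Longrightarrow> k < c j + x"
  unfolding row_start_def by (auto dest: not_less_Least)

text \<open>
  Extending columns could violate antitonicity only between a column \<open>i\<close> left of the new row and a
  column \<open>j\<close> that the row covers. There \<open>c i > k - x \<ge> c j\<close>, so one more cell does no harm.
\<close>

lemma k_columns_antitone:
  assumes "\<forall>x\<in>set \<nu>. x \<le> k" "i \<le> j"
  shows "k_columns k \<nu> j \<le> k_columns k \<nu> i"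
  using assms
proof (induction \<nu> arbitrary: i j)
  case (Cons x xs)
  let ?c = "k_columns k xs" and ?s = "row_start k x (k_columns k xs)"
  have anti: "?c b \<le> ?c a" if "a \<le> b" for a b using Cons that by auto
  have fits: "?c ?s + x \<le> k" using Cons.prems by (intro row_start_fits) auto
  show ?case
  proof (cases "i < ?s \<and> ?s \<le> j")
    case True
    then have "?c j + 1 \<le> ?c i"
      using anti[of ?s j] fits before_row_start[of i k x ?c] by linarith
    then show ?thesis by auto
  next
    case False
    then show ?thesis using anti[OF Cons.prems(2)] Cons.prems(2) by auto
  qed
qed auto

definition column_length :: "(nat \<times> nat) set \<Rightarrow> nat \<Rightarrow> nat" where
  "column_length D j = card {i. (i, j) \<in> D}"

lemma finite_column: "finite {i. (i, j) \<in> skew_diagram \<gamma> \<rho>}"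
  by (rule finite_subset[of _ "{..<length \<gamma>}"])
    (auto simp: skew_diagram_def nth_default_def split: if_splits)

lemma card_row: "card {j. (i, j) \<in> skew_diagram \<gamma> \<rho>} = nth_default 0 \<gamma> i - nth_default 0 \<rho> i"
proof -
  have "{j. (i, j) \<in> skew_diagram \<gamma> \<rho>} = {nth_default 0 \<rho> i..<nth_default 0 \<gamma> i}"
    by (auto simp: skew_diagram_def)
  then show ?thesis by simp
qed

lemma skew_diagram_tl_iff:
  "(i, j) \<in> skew_diagram (tl \<gamma>) (tl \<rho>) \<longleftrightarrow> (Suc i, j) \<in> skew_diagram \<gamma> \<rho>"
  by (simp add: skew_diagram_def nth_default_tl)

lemma diagram_tl_iff: "(i, j) \<in> diagram (tl \<rho>) \<longleftrightarrow> (Suc i, j) \<in> diagram \<rho>"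
  by (simp add: diagram_def nth_default_tl)

lemma column_length_bottom:
  "column_length (skew_diagram \<gamma> \<rho>) j =
     column_length (skew_diagram (tl \<gamma>) (tl \<rho>)) j +
     (if nth_default 0 \<rho> 0 \<le> j \<and> j < nth_default 0 \<gamma> 0 then 1 else 0)"
proof -
  let ?D = "skew_diagram \<gamma> \<rho>" and ?E = "skew_diagram (tl \<gamma>) (tl \<rho>)"
  have "{i. (i, j) \<in> ?D} = Suc ` {i. (i, j) \<in> ?E} \<union> (if (0, j) \<in> ?D then {0} else {})"
    (is "?l = ?r")
  proof (rule set_eqI)
    fix i show "i \<in> ?l \<longleftrightarrow> i \<in> ?r" by (cases i) (auto simp: skew_diagram_tl_iff)
  qed
  then show ?thesis
    using finite_column[of j "tl \<gamma>" "tl \<rho>"]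
    by (simp add: column_length_def card_image card_insert_if)
      (simp add: skew_diagram_def)
qed

lemma hook_length_Suc:
  "hook_length (skew_diagram \<gamma> \<rho>) (Suc i) j = hook_length (skew_diagram (tl \<gamma>) (tl \<rho>)) i j"
proof -
  let ?f = "\<lambda>(a, b). (Suc a, b :: nat)"
  have "{(a, b) \<in> skew_diagram \<gamma> \<rho>. (a = Suc i \<and> b \<ge> j) \<or> (b = j \<and> a \<ge> Suc i)} =
    ?f ` {(a, b) \<in> skew_diagram (tl \<gamma>) (tl \<rho>). (a = i \<and> b \<ge> j) \<or> (b = j \<and> a \<ge> i)}"
    (is "?l = ?r")
  proof (rule set_eqI, clarify)
    fix a b show "(a, b) \<in> ?l \<longleftrightarrow> (a, b) \<in> ?r"
      by (cases a) (auto simp: skew_diagram_tl_iff image_iff)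
  qed
  moreover have "inj ?f" by (auto simp: inj_def)
  ultimately show ?thesis unfolding hook_length_def
    by (metis (no_types, lifting) card_image inj_on_subset subset_UNIV)
qed

text \<open>
  The maximum covers both kinds of squares: those of the bottom row itself, and those to the left
  of it, whose arm is the whole row.
\<close>

lemma hook_length_0:
  "hook_length (skew_diagram \<gamma> \<rho>) 0 j =
     (nth_default 0 \<gamma> 0 - max j (nth_default 0 \<rho> 0)) +
     column_length (skew_diagram (tl \<gamma>) (tl \<rho>)) j"
proof -
  let ?row = "Pair (0::nat) ` {max j (nth_default 0 \<rho> 0)..<nth_default 0 \<gamma> 0}"
  let ?col = "(\<lambda>i. (Suc i, j)) ` {i. (i, j) \<in> skew_diagram (tl \<gamma>) (tl \<rho>)}"
  have "{(a, b) \<in> skew_diagram \<gamma> \<rho>. (a = 0 \<and> b \<ge> j) \<or> (b = j \<and> a \<ge> 0)} = ?row \<union> ?col"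
    (is "?l = _")
  proof (rule set_eqI, clarify)
    fix a b show "(a, b) \<in> ?l \<longleftrightarrow> (a, b) \<in> ?row \<union> ?col"
      by (cases a) (auto simp: skew_diagram_def nth_default_tl)
  qed
  moreover have "card (?row \<union> ?col) = card ?row + card ?col"
    by (rule card_Un_disjoint) (auto simp: finite_column)
  moreover have "card ?row = nth_default 0 \<gamma> 0 - max j (nth_default 0 \<rho> 0)"
    by (subst card_image) (auto simp: inj_on_def)
  moreover have "card ?col = column_length (skew_diagram (tl \<gamma>) (tl \<rho>)) j"
    unfolding column_length_def by (rule card_image) (auto simp: inj_on_def)
  ultimately show ?thesis unfolding hook_length_def by simp
qed

lemma is_k_skew_tl:
  assumes "is_k_skew k (x # xs) \<gamma> \<rho>"
  shows "is_k_skew k xs (tl \<gamma>) (tl \<rho>)"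
  unfolding is_k_skew_def
proof (intro conjI allI ballI; (clarify)?)
  note H = assms[unfolded is_k_skew_def]
  show "is_partition (tl \<gamma>)" "is_partition (tl \<rho>)" using H by (auto intro: is_partition_tl)
  show "contained (tl \<rho>) (tl \<gamma>)" using H by (simp add: contained_def nth_default_tl)
  show "card {j. (i, j) \<in> skew_diagram (tl \<gamma>) (tl \<rho>)} = nth_default 0 xs i" for i
    using H by (simp add: skew_diagram_tl_iff)
  show "hook_length (skew_diagram (tl \<gamma>) (tl \<rho>)) i j \<le> k"
    if "(i, j) \<in> skew_diagram (tl \<gamma>) (tl \<rho>)" for i j
    using H that by (fastforce simp: skew_diagram_tl_iff simp flip: hook_length_Suc)
  show "k < hook_length (skew_diagram (tl \<gamma>) (tl \<rho>)) i j"
    if "(i, j) \<in> diagram (tl \<rho>)" for i j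
    using H that by (fastforce simp: diagram_tl_iff simp flip: hook_length_Suc)
qed

lemma is_k_skew_Nil_iff: "is_k_skew k [] \<gamma> \<rho> \<longleftrightarrow> \<gamma> = [] \<and> \<rho> = []"
proof
  assume H: "is_k_skew k [] \<gamma> \<rho>"
  then have parts: "is_partition \<gamma>" "is_partition \<rho>" by (auto simp: is_k_skew_def)
  have rows: "nth_default 0 \<gamma> i \<le> nth_default 0 \<rho> i" for i
    using H by (simp add: is_k_skew_def card_row)
  then have "skew_diagram \<gamma> \<rho> = {}"
    by (auto simp: skew_diagram_def not_less dest: order_trans)
  then have hook: "hook_length (skew_diagram \<gamma> \<rho>) i j = 0" for i j
    by (simp add: hook_length_def)
  then have "diagram \<rho> = {}" using H unfolding is_k_skew_def by fastforce
  then have zero: "nth_default 0 \<rho> i = 0" for i by (auto simp: diagram_def)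
  then have "nth_default 0 \<gamma> i = 0" for i using rows[of i] by simp
  with zero show "\<gamma> = [] \<and> \<rho> = []"
    using partition_nth_default_eq_0_iff[OF parts(1), of 0]
      partition_nth_default_eq_0_iff[OF parts(2), of 0] by simp
next
  assume "\<gamma> = [] \<and> \<rho> = []"
  then show "is_k_skew k [] \<gamma> \<rho>"
    by (simp add: is_k_skew_def is_partition_def contained_def skew_diagram_def diagram_def)
qed

text \<open>
  Uniqueness of the placement: the first cell of the row has hook-length at most \<open>k\<close>, all squares to
  its left have a larger one, and this is what characterises the least column in which the row fits.
\<close>

lemma is_k_skew_bottom_row:
  assumes "is_k_skew k (x # xs) \<gamma> \<rho>" "0 < x"
  shows "nth_default 0 \<rho> 0 =
           row_start k x (column_length (skew_diagram (tl \<gamma>) (tl \<rho>)))" (is "?s = row_start k x ?c")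
    and "nth_default 0 \<gamma> 0 = nth_default 0 \<rho> 0 + x"
proof -
  note H = assms(1)[unfolded is_k_skew_def]
  have "nth_default 0 \<gamma> 0 - ?s = x"
    using H card_row[of 0 \<gamma> \<rho>] by (metis nth_default_Cons_0)
  then show \<gamma>0: "nth_default 0 \<gamma> 0 = ?s + x" using assms(2) by linarith
  have "(0, ?s) \<in> skew_diagram \<gamma> \<rho>" using \<gamma>0 assms(2) by (simp add: skew_diagram_def)
  then have "hook_length (skew_diagram \<gamma> \<rho>) 0 ?s \<le> k" using H by blast
  then have "?c ?s + x \<le> k" by (simp add: hook_length_0 \<gamma>0)
  moreover have "?s \<le> j" if "?c j + x \<le> k" for j
  proof (rule ccontr)
    assume "\<not> ?s \<le> j"
    then have "(0, j) \<in> diagram \<rho>" by (simp add: diagram_def)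
    then have "k < hook_length (skew_diagram \<gamma> \<rho>) 0 j" using H by blast
    then show False using that \<open>\<not> ?s \<le> j\<close> by (simp add: hook_length_0 \<gamma>0 max_def)
  qed
  ultimately show "?s = row_start k x ?c"
    unfolding row_start_def by (intro Least_equality[symmetric])
qed

lemma column_length_k_skew:
  assumes "is_k_skew k \<nu> \<gamma> \<rho>" "0 \<notin> set \<nu>"
  shows "column_length (skew_diagram \<gamma> \<rho>) = k_columns k \<nu>"
  using assms
proof (induction \<nu> arbitrary: \<gamma> \<rho>)
  case Nil
  then show ?case by (simp add: is_k_skew_Nil_iff column_length_def skew_diagram_def fun_eq_iff)
next
  case (Cons x xs)
  have tl: "column_length (skew_diagram (tl \<gamma>) (tl \<rho>)) = k_columns k xs"
    using Cons.IH[OF is_k_skew_tl[OF Cons.prems(1)]] Cons.prems(2) by simp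
  have "0 < x" using Cons.prems(2) by auto
  note bottom = is_k_skew_bottom_row[OF Cons.prems(1) this, unfolded tl]
  show ?case
    by (rule ext) (simp only: column_length_bottom[of \<gamma> \<rho>] tl bottom k_columns.simps)
qed

lemma is_k_skew_unique:
  assumes "is_k_skew k \<nu> \<gamma> \<rho>" "is_k_skew k \<nu> \<gamma>' \<rho>'" "0 \<notin> set \<nu>"
  shows "\<gamma> = \<gamma>' \<and> \<rho> = \<rho>'"
  using assms
proof (induction \<nu> arbitrary: \<gamma> \<rho> \<gamma>' \<rho>')
  case (Cons x xs)
  have tl: "tl \<gamma> = tl \<gamma>' \<and> tl \<rho> = tl \<rho>'"
    using Cons.IH[OF is_k_skew_tl[OF Cons.prems(1)] is_k_skew_tl[OF Cons.prems(2)]] Cons.prems(3)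
    by simp
  have x: "0 < x" using Cons.prems by auto
  have bottom: "nth_default 0 \<rho> 0 = nth_default 0 \<rho>' 0" "nth_default 0 \<gamma> 0 = nth_default 0 \<gamma>' 0"
    using is_k_skew_bottom_row[OF Cons.prems(1) x] is_k_skew_bottom_row[OF Cons.prems(2) x]
    by (simp_all only: tl)
  have "nth_default 0 \<rho> i = nth_default 0 \<rho>' i \<and> nth_default 0 \<gamma> i = nth_default 0 \<gamma>' i" for i
  proof (cases i)
    case (Suc i')
    then show ?thesis
      using tl nth_default_tl[of 0 \<rho> i'] nth_default_tl[of 0 \<rho>' i']
        nth_default_tl[of 0 \<gamma> i'] nth_default_tl[of 0 \<gamma>' i'] by simp
  qed (use bottom in simp)
  then show ?case
    using Cons.prems unfolding is_k_skew_def by (blast intro: partition_eqI)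
qed (auto simp: is_k_skew_Nil_iff)

text \<open>
  The row is put where \<open>row_start\<close> says. Hook-lengths decrease along it, since column lengths are
  antitone, so it suffices that they are right at its first cell. What needs an argument is that the
  shape and the part below it are again partitions: the row must not start to the left of the row
  above it. Otherwise the square over its first cell would lie below the old diagram and
  have hook-length greater than \<open>k\<close>, although its arm is at most \<open>x\<close> and its leg at most that of the
  first cell.
\<close>

lemma is_k_skew_exists:
  assumes "\<nu> \<in> bounded_partitions k"
  shows "\<exists>\<gamma> \<rho>. is_k_skew k \<nu> \<gamma> \<rho>"
  using assms
proof (induction \<nu>)
  case Nil
  show ?case by (simp add: is_k_skew_Nil_iff)
next
  case (Cons x xs)
  have x: "0 < x" "x \<le> k" "nth_default 0 xs 0 \<le> x" and xs: "xs \<in> bounded_partitions k"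
    using Cons.prems by (auto simp: bounded_partitions_Cons_iff)
  then obtain \<gamma> \<rho> where G: "is_k_skew k xs \<gamma> \<rho>" using Cons.IH by blast
  note H = G[unfolded is_k_skew_def]
  let ?c = "k_columns k xs"
  define s where "s = row_start k x ?c"
  have cl: "column_length (skew_diagram \<gamma> \<rho>) = ?c"
    using column_length_k_skew[OF G] xs by (auto simp: bounded_partitions_def is_partition_def)
  have fits: "?c s + x \<le> k" unfolding s_def using x by (intro row_start_fits)
  have anti: "?c b \<le> ?c a" if "a \<le> b" for a b
    using k_columns_antitone[OF _ that] xs by (auto simp: bounded_partitions_iff)
  have \<rho>0: "nth_default 0 \<rho> 0 \<le> s"
  proof (rule ccontr)
    assume less: "\<not> nth_default 0 \<rho> 0 \<le> s"
    then have "k < hook_length (skew_diagram \<gamma> \<rho>) 0 s" using H by (auto simp: diagram_def)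
    moreover have "nth_default 0 \<gamma> 0 - nth_default 0 \<rho> 0 \<le> x"
      using H x(3) card_row[of 0 \<gamma> \<rho>] by simp
    moreover have "column_length (skew_diagram (tl \<gamma>) (tl \<rho>)) s \<le> ?c s"
      using column_length_bottom[of \<gamma> \<rho> s] cl by simp
    ultimately show False using fits less by (simp add: hook_length_0 max_def)
  qed
  have \<gamma>0: "nth_default 0 \<gamma> 0 \<le> s + x"
    using H x(3) card_row[of 0 \<gamma> \<rho>] \<rho>0 by simp
  define \<gamma>' where "\<gamma>' = (s + x) # \<gamma>"
  \<comment> \<open>A partition has no zero parts; if \<open>s = 0\<close> then \<open>\<rho>\<close> is empty as well, so nothing is lost.\<close>
  define \<rho>' where "\<rho>' = (if s = 0 then [] else s # \<rho>)"
  have \<gamma>p: "is_partition \<gamma>'" using H x \<gamma>0 by (simp add: \<gamma>'_def is_partition_Cons_iff)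
  have \<rho>p: "is_partition \<rho>'"
    using H \<rho>0 by (simp add: \<rho>'_def is_partition_Cons_iff) (simp add: is_partition_def)
  have "\<rho> = []" if "s = 0"
    using that \<rho>0 H partition_nth_default_eq_0_iff[of \<rho> 0] by simp
  then have tl: "tl \<gamma>' = \<gamma>" "tl \<rho>' = \<rho>" by (auto simp: \<gamma>'_def \<rho>'_def)
  have bottom: "nth_default 0 \<gamma>' 0 = s + x" "nth_default 0 \<rho>' 0 = s"
    by (auto simp: \<gamma>'_def \<rho>'_def)
  have "is_k_skew k (x # xs) \<gamma>' \<rho>'"
    unfolding is_k_skew_def
  proof (intro conjI allI ballI; (clarify)?)
    show "contained \<rho>' \<gamma>'" unfolding contained_def
    proof
      fix i show "nth_default 0 \<rho>' i \<le> nth_default 0 \<gamma>' i"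
        using H bottom tl nth_default_tl[of 0 \<rho>'] nth_default_tl[of 0 \<gamma>']
        by (cases i) (auto simp: contained_def)
    qed
    show "card {j. (i, j) \<in> skew_diagram \<gamma>' \<rho>'} = nth_default 0 (x # xs) i" for i
      using H bottom tl nth_default_tl[of 0 \<rho>'] nth_default_tl[of 0 \<gamma>']
      by (cases i) (auto simp: card_row)
    show "hook_length (skew_diagram \<gamma>' \<rho>') i j \<le> k" if "(i, j) \<in> skew_diagram \<gamma>' \<rho>'" for i j
    proof (cases i)
      case 0
      then have "s \<le> j" using that bottom by (simp add: skew_diagram_def)
      then show ?thesis using fits anti[of s j] by (simp add: 0 hook_length_0 bottom tl cl)
    next
      case (Suc i')
      then show ?thesis using H that tl skew_diagram_tl_iff[of i' j \<gamma>' \<rho>']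
        by (auto simp: hook_length_Suc)
    qed
    show "k < hook_length (skew_diagram \<gamma>' \<rho>') i j" if "(i, j) \<in> diagram \<rho>'" for i j
    proof (cases i)
      case 0
      then have "j < s" using that bottom by (simp add: diagram_def)
      then show ?thesis using before_row_start[of j k x ?c]
        by (simp add: 0 hook_length_0 bottom tl cl max_def s_def)
    next
      case (Suc i')
      then show ?thesis using H that tl diagram_tl_iff[of i' j \<rho>']
        by (auto simp: hook_length_Suc)
    qed
  qed (fact \<gamma>p \<rho>p)+
  then show ?case by blast
qed

lemma nth_default_k_conjugate:
  assumes "\<nu> \<in> bounded_partitions k"
  shows "nth_default 0 (k_conjugate k \<nu>) j = k_columns k \<nu> j"
proof -
  obtain \<gamma> \<rho> where G: "is_k_skew k \<nu> \<gamma> \<rho>" using is_k_skew_exists[OF assms] by blast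
  have nz: "0 \<notin> set \<nu>" using assms by (auto simp: bounded_partitions_def is_partition_def)
  have eq: "k_skew k \<nu> = (\<gamma>, \<rho>)"
    unfolding k_skew_def
  proof (rule the_equality)
    show "case (\<gamma>, \<rho>) of (\<gamma>, \<rho>) \<Rightarrow> is_k_skew k \<nu> \<gamma> \<rho>" using G by simp
    show "q = (\<gamma>, \<rho>)" if "case q of (\<gamma>, \<rho>) \<Rightarrow> is_k_skew k \<nu> \<gamma> \<rho>" for q
      using that is_k_skew_unique[OF _ G nz] by (cases q) simp
  qed
  have "column_length (skew_diagram \<gamma> \<rho>) j = 0" if "nth_default 0 \<gamma> 0 \<le> j"
  proof -
    have "nth_default 0 \<gamma> i \<le> j" for i
      using that partition_antitone[of \<gamma> 0 i] G by (auto simp: is_k_skew_def)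
    then have "{i. (i, j) \<in> skew_diagram \<gamma> \<rho>} = {}" by (auto simp: skew_diagram_def not_less)
    then show ?thesis by (simp add: column_length_def)
  qed
  then have "nth_default 0 (k_conjugate k \<nu>) j = column_length (skew_diagram \<gamma> \<rho>) j"
    by (auto simp: k_conjugate_def eq nth_default_def column_length_def)
  then show ?thesis using column_length_k_skew[OF G nz] by simp
qed

lemma contained_k_conjugate_iff:
  assumes "\<nu> \<in> bounded_partitions k" "\<mu> \<in> bounded_partitions k"
  shows "contained (k_conjugate k \<nu>) (k_conjugate k \<mu>) \<longleftrightarrow>
    (\<forall>j. k_columns k \<nu> j \<le> k_columns k \<mu> j)"
  using assms by (simp add: contained_def nth_default_k_conjugate)

section \<open>Partitions with few short rows\<close>

definition few_short_rows :: "nat \<Rightarrow> nat \<Rightarrow> nat list set" where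
  "few_short_rows k m =
     {\<nu>. is_partition \<nu> \<and> (\<forall>x\<in>set \<nu>. x \<le> m) \<and> length (filter (\<lambda>x. x < m) \<nu>) \<le> k + 1 - m}"

lemma few_short_rows_bounded:
  "\<nu> \<in> few_short_rows k m \<Longrightarrow> m \<le> k \<Longrightarrow> \<nu> \<in> bounded_partitions k"
  by (auto simp: few_short_rows_def bounded_partitions_iff)

text \<open>
  Counting parts by their positions makes the counts for two partitions comparable: containment is
  a statement about positions. Padding with zeros is harmless for predicates that fail at \<open>0\<close>.
\<close>

lemma length_filter_conv_nth_default:
  assumes "\<not> P 0"
  shows "length (filter P xs) = card {i. P (nth_default (0::nat) xs i)}"
proof -
  have "{i. P (nth_default 0 xs i)} = {i. i < length xs \<and> P (xs ! i)}"
    using assms by (auto simp: nth_default_def split: if_splits)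
  then show ?thesis by (simp add: length_filter_conv_card)
qed

lemma finite_nth_default:
  assumes "\<not> P 0"
  shows "finite {i. P (nth_default (0::nat) xs i)}"
  by (rule finite_subset[of _ "{..<length xs}"])
    (use assms in \<open>auto simp: nth_default_def split: if_splits\<close>)

definition conjugate_part :: "nat list \<Rightarrow> nat \<Rightarrow> nat" where
  "conjugate_part \<nu> i = length (filter (\<lambda>x. i < x) \<nu>)"

lemma conjugate_part_mono:
  assumes "contained \<nu> \<mu>"
  shows "conjugate_part \<nu> i \<le> conjugate_part \<mu> i"
  unfolding conjugate_part_def length_filter_conv_nth_default[of "\<lambda>x. i < x", OF not_less0]
  by (rule card_mono[OF finite_nth_default])
    (use assms in \<open>auto simp: contained_def intro: less_le_trans\<close>)

text \<open>
  Column \<open>j = i + q * m\<close> holds the \<open>q\<close>-th piece, of length \<open>p = k + 1 - m\<close>, of the \<open>i\<close>-th column of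
  the ordinary diagram; truncated subtraction and the minimum yield \<open>0\<close> for the pieces not yet begun
  and \<open>p\<close> for those completed. The short rows form a diagram whose hook-lengths are at most \<open>k\<close>, so
  they all start in column \<open>0\<close>. A row of \<open>m\<close> cells starts in the first column \<open>s\<close> of length less
  than \<open>p\<close> and covers the window from \<open>s\<close> to \<open>s + m - 1\<close>. The window contains one column of each residue class
  modulo \<open>m\<close>, namely the first one in its class that is not complete, which is where the formula
  puts the new cell.
\<close>

lemma k_columns_few_short_rows:
  assumes "\<nu> \<in> few_short_rows k m" "1 \<le> m" "m \<le> k"
  shows "k_columns k \<nu> j =
    min (k + 1 - m) (conjugate_part \<nu> (j mod m) - (j div m) * (k + 1 - m))"
  using assms(1)
proof (induction \<nu> arbitrary: j)
  case Nil
  show ?case by (simp add: conjugate_part_def)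
next
  case (Cons x xs)
  define p where "p = k + 1 - m"
  let ?c = "k_columns k xs" and ?t = "conjugate_part xs"
  define s where "s = row_start k x ?c"
  have xm: "x \<le> m" "0 < x"
    and xs: "xs \<in> few_short_rows k m"
    using Cons.prems by (auto simp: few_short_rows_def is_partition_Cons_iff split: if_splits)
  have c: "?c j = min p (?t (j mod m) - (j div m) * p)" for j
    using Cons.IH[OF xs] by (simp add: p_def)
  have fits: "?c s + x \<le> k" unfolding s_def using xm assms by (intro row_start_fits) auto
  have early: "k < ?c i + x" if "i < s" for i
    using before_row_start that by (simp add: s_def)
  have anti: "?c b \<le> ?c a" if "a \<le> b" for a b
    using k_columns_antitone[OF _ that] few_short_rows_bounded[OF xs assms(3)]
    by (auto simp: bounded_partitions_iff)
  have "m > 0" using assms by simp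
  have "k_columns k (x # xs) j =
    min p (conjugate_part (x # xs) (j mod m) - (j div m) * p)"
  proof (cases "x = m")
    case True
    have t: "conjugate_part (x # xs) (j mod m) = ?t (j mod m) + 1"
      using True \<open>m > 0\<close> by (simp add: conjugate_part_def)
    \<comment> \<open>The piece in column \<open>j\<close> is complete, growing, or not yet begun, respectively.\<close>
    consider "j < s" | "s \<le> j" "j < s + m" | "s + m \<le> j" by linarith
    then show ?thesis
    proof cases
      case 1
      then have "p \<le> ?c j" using early[of j] True by (simp add: p_def)
      then show ?thesis using 1 c[of j] t by (simp add: s_def)
    next
      case 2
      have "?c j < p" using anti[OF 2(1)] fits True assms by (simp add: p_def)
      moreover have "(j div m) * p \<le> ?t (j mod m)"
      proof (cases "j < m")
        case False
        \<comment> \<open>The previous piece, in column \<open>j - m\<close>, is complete, so that this one has begun.\<close>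
        then have "j - m < s" using 2 by linarith
        then have "p \<le> ?c (j - m)" using early[of "j - m"] True by (simp add: p_def)
        moreover have "j div m = Suc ((j - m) div m)" "j mod m = (j - m) mod m"
          using False \<open>m > 0\<close> by (simp_all add: le_div_geq le_mod_geq)
        moreover have "p > 0" using assms by (simp add: p_def)
        ultimately show ?thesis using c[of "j - m"] by simp
      qed simp
      ultimately show ?thesis using 2 c[of j] t True by (auto simp: s_def)
    next
      case 3
      then have "s \<le> j - m" by linarith
      then have "?c (j - m) < p" using anti[of s "j - m"] fits True assms by (simp add: p_def)
      moreover have "j div m = Suc ((j - m) div m)" "j mod m = (j - m) mod m"
        using 3 \<open>m > 0\<close> by (simp_all add: le_div_geq le_mod_geq)
      ultimately have "?t (j mod m) - (j - m) div m * p < p" "j div m * p = p + (j - m) div m * p"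
        using c[of "j - m"] by (simp_all add: min_def split: if_splits)
      then have "?t (j mod m) + 1 \<le> (j div m) * p" by linarith
      then show ?thesis using 3 c[of j] t True by (simp add: s_def)
    qed
  next
    case False
    then have "x < m" using xm by simp
    then have "filter (\<lambda>y. y < m) (x # xs) = x # xs"
      using Cons.prems by (auto simp: few_short_rows_def is_partition_def intro!: filter_True)
    then have len: "length (x # xs) \<le> p"
      using Cons.prems by (simp add: few_short_rows_def p_def)
    have tlen: "?t i \<le> length xs" for i by (simp add: conjugate_part_def)
    have "?c 0 + x \<le> k"
      using c[of 0] tlen[of 0] len \<open>x < m\<close> \<open>m \<le> k\<close> by (simp add: p_def)
    then have s0: "s = 0" using early[of 0] by force
    show ?thesis
    proof (cases "j < m")
      case True
      have "Suc (length (filter ((<) j) xs)) \<le> p"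
        using len length_filter_le[of "(<) j" xs] by (simp del: length_filter_le)
      then show ?thesis using c[of j] s0 True
        by (simp add: conjugate_part_def s_def)
    next
      case False
      then have "p \<le> (j div m) * p"
        using \<open>m > 0\<close> by (simp add: div_greater_zero_iff Suc_le_eq)
      moreover have "conjugate_part (x # xs) (j mod m) \<le> p"
        unfolding conjugate_part_def by (rule order_trans[OF length_filter_le len])
      moreover have "?t (j mod m) \<le> p" using len tlen[of "j mod m"] by simp
      ultimately have "conjugate_part (x # xs) (j mod m) - j div m * p = 0"
        "?t (j mod m) - j div m * p = 0" by linarith+
      then show ?thesis using c[of j] s0 False \<open>x < m\<close> by (simp only: k_columns.simps s_def) simp
    qed
  qed
  then show ?case by (simp add: p_def)
qed

lemma k_columns_mono:
  assumes "\<nu> \<in> few_short_rows k m" "\<mu> \<in> few_short_rows k m" "1 \<le> m" "m \<le> k" "contained \<nu> \<mu>"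
  shows "k_columns k \<nu> j \<le> k_columns k \<mu> j"
  using conjugate_part_mono[OF assms(5), of "j mod m"]
  by (simp add: k_columns_few_short_rows[OF _ assms(3,4)] assms(1,2) min.coboundedI2 diff_le_mono)

text \<open>
  A short row has at most \<open>m - 1\<close> cells and hence starts in column \<open>0\<close> as long as that column has at
  most \<open>k + 1 - m\<close> cells, so each short row extends column \<open>0\<close> until it has \<open>k + 2 - m\<close> cells.
\<close>

lemma many_short_rows_column_0:
  assumes "sorted_wrt (\<ge>) \<nu>" "0 \<notin> set \<nu>" "m \<le> k"
  shows "min (length (filter (\<lambda>x. x < m) \<nu>)) (k + 2 - m) \<le> k_columns k \<nu> 0"
  using assms(1,2)
proof (induction \<nu>)
  case (Cons x xs)
  then have IH: "min (length (filter (\<lambda>x. x < m) xs)) (k + 2 - m) \<le> k_columns k xs 0" by simp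
  show ?case
  proof (cases "x < m \<and> k_columns k xs 0 + x \<le> k")
    case True
    then have "row_start k x (k_columns k xs) = 0"
      unfolding row_start_def by (intro Least_equality) auto
    then show ?thesis using IH Cons.prems True by auto
  next
    case False
    then show ?thesis using IH \<open>m \<le> k\<close> by auto
  qed
qed auto

section \<open>The order ideal below a rectangle\<close>

lemma few_short_rows_down_closed:
  assumes "Y_cover k \<nu> \<mu>" "\<mu> \<in> few_short_rows k m" "1 \<le> m" "m \<le> k"
  shows "\<nu> \<in> few_short_rows k m"
proof -
  have \<nu>: "\<nu> \<in> bounded_partitions k" and \<mu>: "\<mu> \<in> bounded_partitions k"
    and sub: "contained \<nu> \<mu>" and cols: "\<forall>j. k_columns k \<nu> j \<le> k_columns k \<mu> j"
    using assms(1) contained_k_conjugate_iff by (auto simp: Y_cover_def)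
  have p: "is_partition \<nu>" using \<nu> by (simp add: bounded_partitions_def)
  have "nth_default 0 \<mu> i \<le> m" for i
    using assms(2) by (auto simp: few_short_rows_def nth_default_def)
  then have "nth_default 0 \<nu> i \<le> m" for i
    using sub by (meson contained_def order_trans)
  then have le: "\<forall>x\<in>set \<nu>. x \<le> m"
    by (metis in_set_conv_nth nth_default_nth)
  have "k_columns k \<mu> 0 \<le> k + 1 - m" using k_columns_few_short_rows[OF assms(2-4), of 0] by simp
  then have "k_columns k \<nu> 0 \<le> k + 1 - m" using cols order_trans by blast
  moreover have "min (length (filter (\<lambda>x. x < m) \<nu>)) (k + 2 - m) \<le> k_columns k \<nu> 0"
    using p assms(4) by (intro many_short_rows_column_0) (auto simp: is_partition_def)
  ultimately have "length (filter (\<lambda>x. x < m) \<nu>) \<le> k + 1 - m" using assms(4) by linarith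
  then show ?thesis using p le by (simp add: few_short_rows_def)
qed

lemma length_filter_short:
  assumes "is_partition \<nu>"
  shows "length (filter (\<lambda>x. x < m) \<nu>) = card {i. 0 < nth_default 0 \<nu> i \<and> nth_default 0 \<nu> i < m}"
proof -
  have "filter (\<lambda>x. x < m) \<nu> = filter (\<lambda>x. 0 < x \<and> x < m) \<nu>"
    using assms by (intro filter_cong) (auto simp: is_partition_def intro: gr0I)
  then show ?thesis
    using length_filter_conv_nth_default[of "\<lambda>x. 0 < x \<and> x < m" \<nu>] by simp
qed

text \<open>
  In the first row where the partitions differ a cell can be added: the preceding part is
  already as large as in \<open>\<mu>\<close>.
\<close>

lemma add_cell_between:
  assumes "is_partition \<nu>" "is_partition \<mu>" "contained \<nu> \<mu>" "\<nu> \<noteq> \<mu>"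
  obtains r \<nu>' where "is_partition \<nu>'" "sum_list \<nu>' = sum_list \<nu> + 1"
    and "\<And>i. nth_default 0 \<nu>' i = (if i = r then nth_default 0 \<nu> r + 1 else nth_default 0 \<nu> i)"
    and "\<And>i. i < r \<Longrightarrow> nth_default 0 \<nu> i = nth_default 0 \<mu> i"
    and "nth_default 0 \<nu> r < nth_default 0 \<mu> r"
proof -
  define r where "r = (LEAST i. nth_default 0 \<nu> i \<noteq> nth_default 0 \<mu> i)"
  have "\<exists>i. nth_default 0 \<nu> i \<noteq> nth_default 0 \<mu> i"
    using assms(1,2,4) partition_eqI by blast
  then have ne: "nth_default 0 \<nu> r \<noteq> nth_default 0 \<mu> r" unfolding r_def by (rule LeastI_ex)
  have below: "nth_default 0 \<nu> i = nth_default 0 \<mu> i" if "i < r" for i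
    using that not_less_Least unfolding r_def by blast
  have less: "nth_default 0 \<nu> r < nth_default 0 \<mu> r"
    using ne assms(3) by (simp add: contained_def le_neq_implies_less)
  have rlen: "r \<le> length \<nu>"
  proof (rule ccontr)
    assume "\<not> r \<le> length \<nu>"
    then have "nth_default 0 \<mu> (length \<nu>) = 0" using below[of "length \<nu>"] by (simp add: nth_default_def)
    then show False
      using partition_antitone[OF assms(2), of "length \<nu>" r] less \<open>\<not> r \<le> length \<nu>\<close> by simp
  qed
  define \<nu>' where "\<nu>' = (if r < length \<nu> then \<nu>[r := \<nu> ! r + 1] else \<nu> @ [1])"
  have nth: "nth_default 0 \<nu>' i = (if i = r then nth_default 0 \<nu> r + 1 else nth_default 0 \<nu> i)" for i
    using rlen by (auto simp: \<nu>'_def nth_default_def nth_append)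
  have "0 \<notin> set \<nu>'" using assms(1) set_update_subset_insert[of \<nu> r "\<nu> ! r + 1"]
    by (auto simp: \<nu>'_def is_partition_def)
  moreover have "nth_default 0 \<nu>' j \<le> nth_default 0 \<nu>' i" if "i \<le> j" for i j
  proof (cases "j = r \<and> i < r")
    case True
    then show ?thesis
      using nth below[of i] less partition_antitone[OF assms(2), of i r] by simp
  next
    case False
    then show ?thesis using nth partition_antitone[OF assms(1) that] that
      by (auto intro: le_SucI)
  qed
  ultimately have "is_partition \<nu>'" by (intro is_partitionI)
  moreover have "sum_list \<nu>' = sum_list \<nu> + 1"
    by (auto simp: \<nu>'_def sum_list_update)
  ultimately show ?thesis using that nth below less by blast
qed

text \<open>
  Adding a cell creates a new short row only if it opens a new row \<open>r\<close>. All earlier rows then agree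
  with those of \<open>\<mu>\<close>. If row \<open>r\<close> of \<open>\<mu>\<close> is short, the short rows obtained are among the positions of
  those of \<open>\<mu>\<close>. If it has \<open>m\<close> cells, so have all earlier rows, and the new row is the only short one,
  which is permitted since \<open>m \<le> k\<close>.
\<close>

lemma add_cell_few_short_rows:
  assumes "\<nu> \<in> few_short_rows k m" "\<mu> \<in> few_short_rows k m" "m \<le> k" "contained \<nu> \<mu>" "\<nu> \<noteq> \<mu>"
  obtains \<nu>' where "\<nu>' \<in> few_short_rows k m" "contained \<nu> \<nu>'" "contained \<nu>' \<mu>"
    "sum_list \<nu>' = sum_list \<nu> + 1"
proof -
  have p: "is_partition \<nu>" "is_partition \<mu>" using assms by (auto simp: few_short_rows_def)
  obtain r \<nu>' where \<nu>': "is_partition \<nu>'" "sum_list \<nu>' = sum_list \<nu> + 1"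
    and nth: "\<And>i. nth_default 0 \<nu>' i = (if i = r then nth_default 0 \<nu> r + 1 else nth_default 0 \<nu> i)"
    and below: "\<And>i. i < r \<Longrightarrow> nth_default 0 \<nu> i = nth_default 0 \<mu> i"
    and less: "nth_default 0 \<nu> r < nth_default 0 \<mu> r"
    using add_cell_between[OF p assms(4,5)] by metis
  have sub: "contained \<nu>' \<mu>" using assms(4) nth less by (auto simp: contained_def)
  have \<mu>m: "nth_default 0 \<mu> i \<le> m" for i
    using assms(2) by (auto simp: few_short_rows_def nth_default_def)
  have le: "\<forall>x\<in>set \<nu>'. x \<le> m"
    using \<mu>m sub by (metis contained_def in_set_conv_nth nth_default_nth order_trans)
  let ?short = "\<lambda>\<alpha>. {i. 0 < nth_default 0 \<alpha> i \<and> nth_default 0 \<alpha> i < m}"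
  have fin: "finite (?short \<alpha>)" for \<alpha>
    using finite_nth_default[of "\<lambda>x. 0 < x \<and> x < m"] by simp
  have "card (?short \<nu>') \<le> k + 1 - m"
  proof (cases "0 < nth_default 0 \<nu> r")
    case True
    then have "?short \<nu>' \<subseteq> ?short \<nu>" using nth by (auto split: if_splits)
    from card_mono[OF fin this] show ?thesis
      using assms(1) p by (simp add: few_short_rows_def length_filter_short)
  next
    case False
    then have above: "nth_default 0 \<nu>' i = 0" if "r < i" for i
      using nth partition_antitone[OF p(1), of r i] that by simp
    show ?thesis
    proof (cases "nth_default 0 \<mu> r < m")
      case True
      have "?short \<nu>' \<subseteq> ?short \<mu>"
      proof
        fix i assume "i \<in> ?short \<nu>'"
        then show "i \<in> ?short \<mu>"
          using above[of i] nth[of i] below[of i] less True by (cases i r rule: linorder_cases) auto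
      qed
      from card_mono[OF fin this] show ?thesis
        using assms(2) p by (simp add: few_short_rows_def length_filter_short)
    next
      case False
      have "?short \<nu>' \<subseteq> {r}"
      proof
        fix i assume "i \<in> ?short \<nu>'"
        then show "i \<in> {r}"
          using above[of i] nth[of i] below[of i] False partition_antitone[OF p(2), of i r]
          by (cases i r rule: linorder_cases) auto
      qed
      from card_mono[OF _ this] show ?thesis using assms(3) by simp
    qed
  qed
  then have "\<nu>' \<in> few_short_rows k m"
    using \<nu>'(1) le by (simp add: few_short_rows_def length_filter_short)
  moreover have "contained \<nu> \<nu>'" using nth by (simp add: contained_def)
  ultimately show ?thesis using that sub \<nu>'(2) by blast
qed

lemma sum_list_contained:
  assumes "contained \<nu> \<mu>"
  shows "sum_list \<nu> \<le> sum_list \<mu>"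
  using assms
proof (induction \<nu> arbitrary: \<mu>)
  case (Cons x xs)
  have "contained xs (tl \<mu>)"
    using Cons.prems by (auto simp: contained_def nth_default_tl dest: spec[of _ "Suc _"])
  then have "sum_list xs \<le> sum_list (tl \<mu>)" by (rule Cons.IH)
  moreover have "x \<le> nth_default 0 \<mu> 0"
    using Cons.prems by (auto simp: contained_def dest: spec[of _ 0])
  ultimately show ?case by (cases \<mu>) auto
qed simp

lemma contained_imp_Y_le:
  assumes "\<nu> \<in> few_short_rows k m" "\<mu> \<in> few_short_rows k m" "1 \<le> m" "m \<le> k" "contained \<nu> \<mu>"
  shows "Y_le k \<nu> \<mu>"
  using assms(1,5)
proof (induction "sum_list \<mu> - sum_list \<nu>" arbitrary: \<nu> rule: less_induct)
  case less
  show ?case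
  proof (cases "\<nu> = \<mu>")
    case False
    then obtain \<nu>' where \<nu>': "\<nu>' \<in> few_short_rows k m" "contained \<nu> \<nu>'" "contained \<nu>' \<mu>"
      "sum_list \<nu>' = sum_list \<nu> + 1"
      using add_cell_few_short_rows[OF less.prems(1) assms(2,4) less.prems(2)] by metis
    have "Y_cover k \<nu> \<nu>'"
      unfolding Y_cover_def
      using \<nu>' less.prems assms few_short_rows_bounded contained_k_conjugate_iff k_columns_mono
      by auto
    moreover have "Y_le k \<nu>' \<mu>"
      using less.hyps[OF _ \<nu>'(1,3)] \<nu>'(4) sum_list_contained[OF \<nu>'(3)] by simp
    ultimately show ?thesis
      unfolding Y_le_def by (rule converse_rtranclp_into_rtranclp)
  qed (simp add: Y_le_def)
qed

lemma Y_le_imp_contained: "Y_le k \<nu> \<mu> \<Longrightarrow> contained \<nu> \<mu>"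
  unfolding Y_le_def
  by (induction rule: rtranclp_induct)
    (auto simp: Y_cover_def contained_def intro: order_trans)

lemma replicate_few_short_rows: "1 \<le> m \<Longrightarrow> replicate n m \<in> few_short_rows k m"
  by (auto simp: few_short_rows_def is_partition_def sorted_wrt_iff_nth_less)

lemma Lk_subset_few_short_rows:
  assumes "1 \<le> m" "m \<le> k"
  shows "Lk k m n \<subseteq> few_short_rows k m"
proof
  fix \<nu> assume "\<nu> \<in> Lk k m n"
  then have "(Y_cover k)\<^sup>*\<^sup>* \<nu> (replicate n m)" by (simp add: Lk_def Y_le_def)
  then show "\<nu> \<in> few_short_rows k m"
    by (induction rule: converse_rtranclp_induct)
      (use assms in \<open>auto intro: replicate_few_short_rows few_short_rows_down_closed\<close>)
qed

lemma Lk_subset_L: "Lk k m n \<subseteq> L m n"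
proof
  fix \<nu> assume "\<nu> \<in> Lk k m n"
  then have p: "is_partition \<nu>" and "contained \<nu> (replicate n m)"
    by (auto simp: Lk_def bounded_partitions_def dest: Y_le_imp_contained)
  then have le: "nth_default 0 \<nu> i \<le> (if i < n then m else 0)" for i
    by (auto simp: contained_def nth_default_def dest: spec[of _ i])
  have "length \<nu> \<le> n" using le[of n] partition_nth_default_eq_0_iff[OF p, of n] by simp
  moreover have "x \<le> m" if "x \<in> set \<nu>" for x
  proof -
    obtain i where "x = nth_default 0 \<nu> i" using \<open>x \<in> set \<nu>\<close> by (metis in_set_conv_nth nth_default_nth)
    then show ?thesis using le[of i] by (simp split: if_splits)
  qed
  ultimately show "\<nu> \<in> L m n" using p by (simp add: L_def)
qed

theorem theorem31:
  fixes k m n :: nat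
  assumes "k \<ge> 1" and "m \<ge> 1" and "n \<ge> 1" and "m \<le> k"
  shows "Lk k m n \<subseteq> L m n \<and>
    poset_isomorphic (Lk k m n) (Y_le k) {\<nu> \<in> L m n. \<nu> \<in> Lk k m n} contained \<and>
    (\<forall>\<nu>\<in>Lk k m n. \<forall>\<mu>\<in>Lk k m n. Y_le k \<mu> \<nu> \<longleftrightarrow> contained \<mu> \<nu>)"
proof -
  have iff: "Y_le k \<mu> \<nu> \<longleftrightarrow> contained \<mu> \<nu>" if "\<nu> \<in> Lk k m n" "\<mu> \<in> Lk k m n" for \<mu> \<nu>
    using contained_imp_Y_le[OF _ _ assms(2,4)] Y_le_imp_contained
      Lk_subset_few_short_rows[OF assms(2,4)] that by blast
  moreover have "{\<nu> \<in> L m n. \<nu> \<in> Lk k m n} = Lk k m n" using Lk_subset_L by blast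
  moreover have "poset_isomorphic (Lk k m n) (Y_le k) (Lk k m n) contained"
    unfolding poset_isomorphic_def using iff by (intro exI[of _ id]) auto
  ultimately show ?thesis using Lk_subset_L by auto
qed

end
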